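(* Let $n\geq 1$ be an integer, let $f\in\mathcal{A}_n$, let $\beta,\gamma\in\mathbb{C}$ with $\gamma\neq 0$ and $\operatorname{Re}\left(\frac{\beta}{\gamma}\right)>-(n+1)$, and let $\alpha$ be a real number with $0<\alpha<1$. Suppose that one of the following holds: (i) $0<\alpha\leq\frac12$ and $$\left|\beta\left(\frac{zf'(z)}{f(z)}-1\right)+\gamma\frac{zf''(z)}{f'(z)}\right|<\frac12\,|\beta+\gamma(n+1)|\qquad\text{for all } z\in\mathbb{U};$$ (ii) $\frac12\leq\alpha<1$ and $$\left|\beta\left(\frac{zf'(z)}{f(z)}-1\right)+\gamma\frac{zf''(z)}{f'(z)}\right|<(1-\alpha)\,|\beta+\gamma(n+1)|\qquad\text{for all } z\in\mathbb{U}.$$ Then $$\left|\frac{f(z)}{zf'(z)}-\frac{1}{2\alpha}\right|<\frac{1}{2\alpha}\qquad\text{for all } z\in\mathbb{U},$$ and hence $f\in\mathcal{S}^{*}(\alpha)$.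
   Context: $\mathbb{U}=\{z\in\mathbb{C}:|z|<1\}$ is the open unit disk. For an integer $n\geq1$, $\mathcal{A}_n$ is the class of functions $f(z)=z+a_{n+1}z^{n+1}+a_{n+2}z^{n+2}+\cdots$ analytic in $\mathbb{U}$. For $0\leq\alpha<1$, $\mathcal{S}^{*}(\alpha)$ (starlike functions of order $\alpha$) is the class of $f\in\mathcal{A}_n$ with $\operatorname{Re}\left(\frac{zf'(z)}{f(z)}\right)>\alpha$ for all $z\in\mathbb{U}$. Expressions such as $zf'(z)/f(z)$, $zf''(z)/f'(z)$, $f(z)/(zf'(z))$ and their combinations are understood as meromorphic functions with removable singularities removed (so $zf'(z)/f(z)$ and $f(z)/(zf'(z))$ equal $1$ at $z=0$); in particular, a bound on such an expression for all $z\in\mathbb{U}$ includes that it has no poles in $\mathbb{U}$. *)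

theory Defs
  imports "HOL-Complex_Analysis.Complex_Analysis"
begin

abbreviation unit_disk :: "complex set" where
  "unit_disk \<equiv> ball 0 1"

definition class_A :: "nat \<Rightarrow> (complex \<Rightarrow> complex) set" where
  "class_A n = {f. f holomorphic_on unit_disk \<and>
     (\<exists>a. \<forall>z\<in>unit_disk. (\<lambda>k. a k * z ^ (n + 1 + k)) sums (f z - z))}"

text \<open>
  A pointwise condition on a quotient expression \<open>g\<close>, read as a meromorphic function on the
  disk: \<open>g\<close> has no poles, and the condition is imposed on the values after removable
  singularities are filled in by limits.  Since \<open>remove_sings g z\<close> is \<open>0\<close> at a pole, the
  absence of poles has to be required separately.  The values of \<open>g\<close> at the (isolated) points
  where a denominator vanishes, which HOL sets by \<open>x / 0 = 0\<close>, play no role.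
\<close>

definition mero_holds_on_disk :: "(complex \<Rightarrow> bool) \<Rightarrow> (complex \<Rightarrow> complex) \<Rightarrow> bool" where
  "mero_holds_on_disk P g \<longleftrightarrow>
     (\<forall>z\<in>unit_disk. \<not> is_pole g z \<and> P (remove_sings g z))"

definition starlike_class :: "nat \<Rightarrow> real \<Rightarrow> (complex \<Rightarrow> complex) set" where
  "starlike_class n \<alpha> = {f \<in> class_A n.
     mero_holds_on_disk (\<lambda>w. Re w > \<alpha>) (\<lambda>z. z * deriv f z / f z)}"

end

theory Submission
  imports Defs
begin

text \<open>
  Write \<open>g = f / (z f')\<close> and \<open>h = g - 1\<close>, and let \<open>E\<close> be the expression bounded in the hypothesis.
  Then \<open>\<gamma> z h' + (\<beta> + \<gamma>) h = - E (1 + h)\<close>.  A pole of \<open>g\<close> would be a pole of \<open>g' / g\<close> and hence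
  of \<open>E\<close>, so \<open>h\<close> is holomorphic, and it vanishes to order at least \<open>n\<close> at \<open>0\<close>.  If \<open>z\<^sub>0\<close> is a point of
  least modulus with \<open>|h z\<^sub>0| = R\<close>, Jack's lemma gives \<open>z\<^sub>0 h' z\<^sub>0 = m h z\<^sub>0\<close> with real \<open>m \<ge> n\<close>, so
  \<open>|\<beta> + \<gamma> (m + 1)| R \<le> |E z\<^sub>0| (1 + R)\<close>; since \<open>|\<beta> + \<gamma> (m + 1)|\<close> increases in \<open>m \<ge> n\<close>, this contradicts
  \<open>|E| < R / (1 + R) |\<beta> + \<gamma> (n + 1)|\<close>.  Taking \<open>R = 1\<close> in case (i) and \<open>R = (1 - \<alpha>) / \<alpha>\<close> in case (ii), the
  disk \<open>|g - 1| < R\<close> lies in the required one, which inversion maps onto the half-plane \<open>Re > \<alpha>\<close>.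
\<close>

section \<open>Boundary maxima of holomorphic functions and Jack's lemma\<close>

lemma norm_le_initial_imp_inner_deriv_le_0:
  fixes \<phi> :: "real \<Rightarrow> 'a :: real_inner"
  assumes der: "(\<phi> has_vector_derivative d) (at 0)"
    and le: "\<And>t. t \<ge> 0 \<Longrightarrow> norm (\<phi> t) \<le> norm (\<phi> 0)"
  shows "inner (\<phi> 0) d \<le> 0"
proof (rule ccontr)
  assume "\<not> ?thesis"
  hence pos: "0 < 2 * inner (\<phi> 0) d" by simp
  \<comment> \<open>The squared norm is differentiable even where the norm is not. A positive
    derivative at 0 would make it increase just to the right of 0.\<close>
  have "((\<lambda>t. inner (\<phi> t) (\<phi> t)) has_derivative
          (\<lambda>t. inner (\<phi> 0) (t *\<^sub>R d) + inner (t *\<^sub>R d) (\<phi> 0))) (at 0)"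
    using der by (intro has_derivative_inner) (simp_all add: has_vector_derivative_def)
  hence "((\<lambda>t. inner (\<phi> t) (\<phi> t)) has_real_derivative 2 * inner (\<phi> 0) d) (at 0)"
    by (rule has_derivative_imp_has_field_derivative) (simp add: inner_commute)
  from has_real_derivative_pos_inc_right[OF this pos]
  obtain \<delta> where "\<delta> > 0"
    and \<delta>: "\<And>t. 0 < t \<Longrightarrow> t < \<delta> \<Longrightarrow> inner (\<phi> 0) (\<phi> 0) < inner (\<phi> t) (\<phi> t)"
    by auto
  have "inner (\<phi> (\<delta> / 2)) (\<phi> (\<delta> / 2)) \<le> inner (\<phi> 0) (\<phi> 0)"
    using le[of "\<delta> / 2"] \<open>\<delta> > 0\<close> by (simp add: norm_le)
  with \<delta>[of "\<delta> / 2"] \<open>\<delta> > 0\<close> show False by simp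
qed

text \<open>For \<open>Re v \<le> 0\<close> the curve \<open>z0 * exp (t * v)\<close>,
  \<open>t \<ge> 0\<close>, stays in the closed disk, so \<open>cmod k\<close> never exceeds its
  initial value along it. With \<open>q = z0 * d / k z0\<close> this gives
  \<open>Re (q * v) \<le> 0\<close> on the whole closed left half-plane, which forces
  \<open>q\<close> to be real and nonnegative.\<close>

lemma max_norm_on_disk_log_derivative:
  assumes der: "(k has_field_derivative d) (at z0)" and "k z0 \<noteq> 0"
    and le: "\<And>z. cmod z \<le> cmod z0 \<Longrightarrow> cmod (k z) \<le> cmod (k z0)"
  shows "\<exists>c\<ge>0. z0 * d = of_real c * k z0"
proof -
  have *: "inner (k z0) (z0 * d * v) \<le> 0" if "Re v \<le> 0" for v
  proof -
    define \<phi> where "\<phi> t = k (z0 * exp (of_real t * v))" for t :: real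
    have "((\<lambda>s. z0 * exp (s * v)) has_field_derivative z0 * v) (at 0)"
      by (auto intro!: derivative_eq_intros)
    hence "((\<lambda>s. k (z0 * exp (s * v))) has_field_derivative d * (z0 * v)) (at (of_real 0))"
      using DERIV_chain2[of k d "\<lambda>s. z0 * exp (s * v)" 0] der by simp
    hence "(\<phi> has_vector_derivative d * (z0 * v)) (at 0)"
      unfolding \<phi>_def by (rule has_vector_derivative_real_field)
    hence "inner (\<phi> 0) (d * (z0 * v)) \<le> 0"
    proof (rule norm_le_initial_imp_inner_deriv_le_0)
      fix t :: real assume "t \<ge> 0"
      hence "cmod z0 * exp (t * Re v) \<le> cmod z0"
        using that by (simp add: mult_left_le mult_nonneg_nonpos)
      thus "cmod (\<phi> t) \<le> cmod (\<phi> 0)"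
        unfolding \<phi>_def using le by (simp add: norm_mult)
    qed
    thus ?thesis by (simp add: \<phi>_def mult_ac)
  qed
  define q where "q = z0 * d / k z0"
  have q: "z0 * d = q * k z0" using assms by (simp add: q_def)
  have inner_q: "inner (k z0) (q * k z0 * v) = (cmod (k z0))\<^sup>2 * Re (q * v)" for v
    unfolding cmod_power2 by (simp add: inner_complex_def power2_eq_square algebra_simps)
  have "Re (q * v) \<le> 0" if "Re v \<le> 0" for v
    using *[OF that] assms(2) unfolding q inner_q by (simp add: mult_le_0_iff)
  \<comment> \<open>\<open>v = -1\<close> moves from \<open>z0\<close> towards \<open>0\<close>, \<open>v = \<i>\<close> and \<open>v = -\<i>\<close> move along the circle.\<close>
  from this[of "-1"] this[of \<i>] this[of "-\<i>"] have "Re q \<ge> 0" "Im q = 0" by auto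
  thus ?thesis using q by (intro exI[of _ "Re q"]) (simp add: complex_eq_iff)
qed

text \<open>On the circle through \<open>z0\<close> the factor \<open>z ^ n\<close> has constant
  modulus, so \<open>k\<close> inherits the maximum at \<open>z0\<close> there, and the maximum
  modulus principle extends it to the closed disk. The logarithmic derivative of \<open>h\<close>
  then adds \<open>n\<close> to the nonnegative contribution of \<open>k\<close>.\<close>

lemma Jack_lemma:
  assumes hol: "k holomorphic_on ball 0 r" and h: "\<And>z. z \<in> ball 0 r \<Longrightarrow> h z = z ^ n * k z"
    and z0: "z0 \<in> ball 0 r" and "z0 \<noteq> 0" and "h z0 \<noteq> 0"
    and le: "\<And>z. cmod z \<le> cmod z0 \<Longrightarrow> cmod (h z) \<le> cmod (h z0)"
  shows "\<exists>m\<ge>real n. z0 * deriv h z0 = of_real m * h z0"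
proof -
  have sub: "cball 0 (cmod z0) \<subseteq> ball 0 r" using z0 by auto
  have "cmod (k z) \<le> cmod (k z0)" if "cmod z \<le> cmod z0" for z
  proof (rule maximum_modulus_frontier[of k "cball 0 (cmod z0)"])
    show "k holomorphic_on interior (cball 0 (cmod z0))"
      using hol sub by (meson holomorphic_on_subset interior_subset order_trans)
    show "continuous_on (closure (cball 0 (cmod z0))) k"
      using hol sub by (metis holomorphic_on_imp_continuous_on continuous_on_subset closed_cball closure_closed)
    fix w :: complex assume "w \<in> frontier (cball 0 (cmod z0))"
    hence w: "cmod w = cmod z0" by simp
    hence "cmod (w ^ n * k w) \<le> cmod (z0 ^ n * k z0)"
      using le[of w] h[of w] h[of z0] z0 by simp
    thus "cmod (k w) \<le> cmod (k z0)"
      using w \<open>z0 \<noteq> 0\<close> by (simp add: norm_mult norm_power)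
  qed (use that in auto)
  moreover have der: "(k has_field_derivative deriv k z0) (at z0)"
    using hol z0 holomorphic_derivI by blast
  moreover have "k z0 \<noteq> 0" using h[OF z0] assms by auto
  ultimately obtain c where c: "c \<ge> 0" "z0 * deriv k z0 = of_real c * k z0"
    using max_norm_on_disk_log_derivative by blast
  have "((\<lambda>z. z ^ n * k z) has_field_derivative
          of_nat n * z0 ^ (n - 1) * k z0 + z0 ^ n * deriv k z0) (at z0)"
    using der by (auto intro!: derivative_eq_intros)
  hence "(h has_field_derivative of_nat n * z0 ^ (n - 1) * k z0 + z0 ^ n * deriv k z0) (at z0)"
    by (rule has_field_derivative_transform_within_open[of _ _ _ "ball 0 r"]) (use h z0 in auto)
  hence "z0 * deriv h z0 = z0 * (of_nat n * z0 ^ (n - 1)) * k z0 + z0 ^ n * (z0 * deriv k z0)"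
    by (simp add: DERIV_imp_deriv algebra_simps)
  \<comment> \<open>The case split covers the truncated exponent \<open>n - 1\<close> at
    \<open>n = 0\<close>, where the factor \<open>of_nat n\<close> vanishes.\<close>
  also have "z0 * (of_nat n * z0 ^ (n - 1)) = of_nat n * z0 ^ n"
    by (cases n) auto
  finally have "z0 * deriv h z0 = of_real (real n + c) * h z0"
    unfolding c(2) h[OF z0] by (simp add: algebra_simps)
  thus ?thesis using c(1) by (intro exI[of _ "real n + c"]) simp
qed

section \<open>From a differential equation to a bound on a disk\<close>

lemma first_point_reaching_norm:
  fixes h :: "'a :: euclidean_space \<Rightarrow> 'b :: real_normed_vector"
  assumes cont: "continuous_on (ball 0 r) h" and "norm (h 0) < R"
    and z1: "z1 \<in> ball 0 r" "R \<le> norm (h z1)"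
  obtains z0 where "z0 \<in> ball 0 r" "z0 \<noteq> 0" "norm (h z0) = R"
    "\<And>z. norm z \<le> norm z0 \<Longrightarrow> norm (h z) \<le> R"
proof -
  define S where "S = cball 0 (norm z1) \<inter> (\<lambda>z. norm (h z)) -` {R..}"
  have cont1: "continuous_on (cball 0 (norm z1)) h"
    using z1 by (intro continuous_on_subset[OF cont]) auto
  have "closed S" unfolding S_def
    by (intro continuous_closed_preimage continuous_on_norm cont1) auto
  hence "compact S"
    by (metis S_def Int_lower1 bounded_cball bounded_subset compact_eq_bounded_closed)
  moreover have "S \<noteq> {}" using z1 by (auto simp: S_def)
  ultimately obtain z0 where z0: "z0 \<in> S" and min: "\<And>z. z \<in> S \<Longrightarrow> norm z0 \<le> norm z"
    using continuous_attains_inf[of S norm] by (auto intro: continuous_intros)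
  have z0': "norm z0 \<le> norm z1" "R \<le> norm (h z0)" using z0 by (auto simp: S_def)
  hence "z0 \<noteq> 0" using assms(2) by auto
  have small: "norm (h z) \<le> R" if "norm z < norm z0" for z
    using min[of z] that z0' by (force simp: S_def)
  have le: "norm (h z) \<le> R" if "norm z \<le> norm z0" for z
  \<comment> \<open>Minimality of \<open>z0\<close> gives the bound only on the open ball;
    continuity carries it to the closure, which is the closed ball because
    \<open>z0 \<noteq> 0\<close>.\<close>
  proof (rule continuous_on_closure_norm_le[of "ball 0 (norm z0)" h])
    show "continuous_on (closure (ball 0 (norm z0))) h"
      using z0' \<open>z0 \<noteq> 0\<close> by (intro continuous_on_subset[OF cont1]) auto
  qed (use small that \<open>z0 \<noteq> 0\<close> in auto)
  show ?thesis
    using that[of z0] le z0' \<open>z0 \<noteq> 0\<close> z1 le[of z0] by force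
qed

text \<open>The real part is already positive at \<open>w + a\<close>, so moving to the right only
  increases the modulus. The hypothesis on \<open>Re (\<beta> / \<gamma>)\<close> enters the proof
  through this fact.\<close>

lemma norm_add_of_real_mono:
  assumes "a \<le> b" and "Re w > - a"
  shows "cmod (w + of_real a) \<le> cmod (w + of_real b)"
  using assms by (auto simp: cmod_def intro!: real_sqrt_le_mono power_mono)

lemma disk_bound_from_differential_equation:
  fixes \<beta> \<gamma> :: complex
  assumes hol: "k holomorphic_on unit_disk"
    and h: "\<And>z. z \<in> unit_disk \<Longrightarrow> h z = z ^ n * k z"
    and n: "n \<ge> 1" and "\<gamma> \<noteq> 0" and Re: "Re (\<beta> / \<gamma>) > - (real n + 1)" and R: "R > 0"
    and ode: "\<And>z. z \<in> unit_disk \<Longrightarrow>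
      \<gamma> * (z * deriv h z) + (\<beta> + \<gamma>) * h z = - E z * (1 + h z)"
    and E: "\<And>z. z \<in> unit_disk \<Longrightarrow> cmod (E z) < R / (1 + R) * cmod (\<beta> + \<gamma> * (of_nat n + 1))"
    and z: "z \<in> unit_disk"
  shows "cmod (h z) < R"
proof (rule ccontr)
  assume "\<not> ?thesis"
  hence zR: "R \<le> cmod (h z)" by simp
  have "continuous_on unit_disk (\<lambda>z. z ^ n * k z)"
    using hol by (intro continuous_intros holomorphic_on_imp_continuous_on)
  hence cont: "continuous_on unit_disk h" by (rule continuous_on_eq) (simp add: h)
  have "cmod (h 0) < R" using h[of 0] n R by (simp add: zero_power)
  from first_point_reaching_norm[OF cont this z zR]
  obtain z0 where z0: "z0 \<in> unit_disk" "z0 \<noteq> 0" "cmod (h z0) = R"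
    and le: "\<And>z. cmod z \<le> cmod z0 \<Longrightarrow> cmod (h z) \<le> R" by blast
  obtain m where m: "m \<ge> real n" "z0 * deriv h z0 = of_real m * h z0"
    using Jack_lemma[OF hol h z0(1,2)] z0(3) R le by force
  \<comment> \<open>Taking out \<open>\<gamma>\<close> turns the comparison of \<open>m\<close> with
    \<open>n\<close> into a real shift of \<open>\<beta> / \<gamma>\<close>.\<close>
  have w: "\<beta> + \<gamma> * (of_real x + 1) = \<gamma> * (\<beta> / \<gamma> + of_real (x + 1))" for x
    using \<open>\<gamma> \<noteq> 0\<close> by (simp add: field_simps)
  have "cmod (\<beta> + \<gamma> * (of_real (real n) + 1)) \<le> cmod (\<beta> + \<gamma> * (of_real m + 1))"
    unfolding w norm_mult using m(1) Re
    by (intro mult_left_mono norm_add_of_real_mono) auto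
  hence "cmod (\<beta> + \<gamma> * (of_nat n + 1)) * R \<le> cmod ((\<beta> + \<gamma> * (of_real m + 1)) * h z0)"
    using R by (simp add: norm_mult z0(3))
  also have "(\<beta> + \<gamma> * (of_real m + 1)) * h z0 = - E z0 * (1 + h z0)"
    unfolding ode[OF z0(1), symmetric] m(2) by (simp add: algebra_simps)
  also have "cmod \<dots> \<le> cmod (E z0) * (1 + R)"
    unfolding norm_mult norm_minus_cancel
    using norm_triangle_ineq[of 1 "h z0"] z0(3) by (intro mult_left_mono) auto
  also have "\<dots> < R / (1 + R) * cmod (\<beta> + \<gamma> * (of_nat n + 1)) * (1 + R)"
    using E[OF z0(1)] R by (intro mult_strict_right_mono) auto
  also have "\<dots> = cmod (\<beta> + \<gamma> * (of_nat n + 1)) * R" using R by simp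
  finally show False by simp
qed

section \<open>Power series normalization and the reciprocal quotient\<close>

lemma class_A_factorization:
  assumes "f \<in> class_A n"
  obtains \<phi> where "\<phi> holomorphic_on unit_disk"
    "\<And>z. z \<in> unit_disk \<Longrightarrow> f z = z + z ^ (n + 1) * \<phi> z"
proof -
  from assms obtain a where a: "\<And>z. z \<in> unit_disk \<Longrightarrow> (\<lambda>k. a k * z ^ (n + 1 + k)) sums (f z - z)"
    unfolding class_A_def by blast
  define \<phi> where "\<phi> z = (if z = 0 then a 0 else (f z - z) / z ^ (n + 1))" for z
  have "(\<lambda>k. a k * (z - 0) ^ k) sums \<phi> z" if "z \<in> unit_disk" for z
  proof (cases "z = 0")
    case True
    thus ?thesis using powser_sums_zero[of a] by (simp add: \<phi>_def)
  next
    case False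
    thus ?thesis
      using sums_divide[OF a[OF that], of "z ^ (n + 1)"] by (simp add: \<phi>_def power_add)
  qed
  hence "\<phi> holomorphic_on unit_disk" by (rule power_series_holomorphic)
  \<comment> \<open>At \<open>z = 0\<close> this needs \<open>f 0 = 0\<close>, which the series
    evaluated at 0 supplies.\<close>
  moreover have "f z = z + z ^ (n + 1) * \<phi> z" if "z \<in> unit_disk" for z
    using a[of 0] by (auto simp: \<phi>_def sums_iff)
  ultimately show ?thesis using that by blast
qed

text \<open>Extends identities proved off the zeros of the denominators to those zeros.\<close>

lemma isCont_eq_limit:
  fixes f g :: "'a :: {perfect_space, t2_space} \<Rightarrow> 'b :: t2_space"
  assumes "isCont f z" "isCont g z" "eventually (\<lambda>w. f w = g w) (at z)"
  shows "f z = g z"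
proof -
  have "f \<midarrow>z\<rightarrow> g z"
    using assms(2,3) tendsto_cong[of f g "at z" "g z"] by (simp add: isCont_def)
  thus ?thesis using assms(1) LIM_unique by (auto simp: isCont_def)
qed

text \<open>At a pole of \<open>g\<close> the term with \<open>inverse g\<close> tends to
  \<open>-a\<close>, while \<open>g' / g\<close> tends to infinity. Since
  \<open>z \<noteq> 0\<close>, the factor \<open>w\<close> cannot cancel the simple pole of the
  logarithmic derivative.\<close>

lemma is_pole_log_derivative_expression:
  assumes "isolated_singularity_at g z" "is_pole g z" "\<gamma> \<noteq> 0" "z \<noteq> 0"
  shows "is_pole (\<lambda>w. a * (inverse (g w) - 1) - \<gamma> * (w * (deriv g w / g w))) z"
proof -
  have lim: "filterlim (\<lambda>w. deriv g w / g w) at_infinity (at z)"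
    using is_pole_deriv_divide_is_pole[OF assms(1,2)] by (simp add: is_pole_def)
  have "((\<lambda>w. - \<gamma> * w) \<longlongrightarrow> - \<gamma> * z) (at z)" by (intro tendsto_intros)
  from tendsto_mult_filterlim_at_infinity[OF this _ lim]
  have 1: "filterlim (\<lambda>w. - \<gamma> * w * (deriv g w / g w)) at_infinity (at z)"
    using assms by simp
  have "((\<lambda>w. inverse (g w)) \<longlongrightarrow> 0) (at z)"
    using assms(2) filterlim_compose[OF tendsto_inverse_0] by (auto simp: is_pole_def)
  hence "((\<lambda>w. a * (inverse (g w) - 1)) \<longlongrightarrow> a * (0 - 1)) (at z)"
    by (intro tendsto_intros)
  from tendsto_add_filterlim_at_infinity[OF this 1]
  show ?thesis by (simp add: is_pole_def algebra_simps)
qed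

text \<open>Logarithmic differentiation of \<open>g = f / (z f')\<close> gives
  \<open>z g' / g = 1 / g - 1 - z f'' / f'\<close>, which eliminates the second derivative of
  \<open>f\<close>.\<close>

lemma operator_via_reciprocal:
  assumes hol: "f holomorphic_on S" "open S" "w \<in> S" and nz: "w \<noteq> 0" "f w \<noteq> 0" "deriv f w \<noteq> 0"
  defines "g \<equiv> \<lambda>z. f z / (z * deriv f z)"
  shows "\<beta> * (w * deriv f w / f w - 1) + \<gamma> * (w * deriv (deriv f) w / deriv f w)
    = (\<beta> + \<gamma>) * (inverse (g w) - 1) - \<gamma> * (w * (deriv g w / g w))"
proof -
  have f: "(f has_field_derivative deriv f w) (at w)"
    and f': "(deriv f has_field_derivative deriv (deriv f) w) (at w)"
    using hol holomorphic_deriv holomorphic_derivI by blast+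
  have "(g has_field_derivative (deriv f w * (w * deriv f w) -
      f w * (deriv f w + w * deriv (deriv f) w)) / (w * deriv f w)\<^sup>2) (at w)"
    unfolding g_def using nz
    by (auto intro!: derivative_eq_intros f f' simp: power2_eq_square algebra_simps)
  hence dg: "deriv g w = (deriv f w * (w * deriv f w) -
      f w * (deriv f w + w * deriv (deriv f) w)) / (w * deriv f w)\<^sup>2"
    by (rule DERIV_imp_deriv)
  have gw: "g w = f w / (w * deriv f w)" by (simp add: g_def)
  show ?thesis unfolding dg gw using nz by (simp add: field_simps power2_eq_square)
qed

text \<open>Squaring the disk inequality gives \<open>\<alpha> * |w|^2 < Re w\<close>; division by
  \<open>|w|^2\<close> yields the half-plane.\<close>

lemma disk_half_plane_inverse:
  assumes "\<alpha> > 0" "cmod (w - complex_of_real (1 / (2 * \<alpha>))) < 1 / (2 * \<alpha>)"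
  shows "w \<noteq> 0" "Re (inverse w) > \<alpha>"
proof -
  show "w \<noteq> 0"
  proof
    assume "w = 0"
    hence "cmod (w - complex_of_real (1 / (2 * \<alpha>))) = \<bar>1 / (2 * \<alpha>)\<bar>"
      by (metis diff_0 norm_minus_cancel norm_of_real)
    thus False using assms by simp
  qed
  have "(cmod (w - complex_of_real (1 / (2 * \<alpha>))))\<^sup>2 < (1 / (2 * \<alpha>))\<^sup>2"
    using assms(2) by (intro power_strict_mono) auto
  hence "(Re w)\<^sup>2 + (Im w)\<^sup>2 < 2 * (1 / (2 * \<alpha>)) * Re w"
    unfolding cmod_power2 minus_complex.sel Re_complex_of_real Im_complex_of_real power2_diff
    by (simp add: mult_ac)
  hence "\<alpha> * ((Re w)\<^sup>2 + (Im w)\<^sup>2) < Re w"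
    using assms(1) by (simp add: field_simps)
  moreover have "(Re w)\<^sup>2 + (Im w)\<^sup>2 > 0"
    using \<open>w \<noteq> 0\<close> by (simp add: complex_eq_iff sum_power2_gt_zero_iff)
  ultimately show "Re (inverse w) > \<alpha>" by (simp add: pos_less_divide_eq)
qed

text \<open>A free \<open>R\<close> lets both cases of the theorem be instances. A finite limit
  excludes a pole, determines the value after removing the singularity, and passes easily to the
  reciprocal.\<close>

lemma reciprocal_minus_one_bound:
  fixes f :: "complex \<Rightarrow> complex"
  assumes n: "n \<ge> 1" and f: "f \<in> class_A n" and \<gamma>: "\<gamma> \<noteq> 0"
    and Re: "Re (\<beta> / \<gamma>) > - (real n + 1)" and R: "R > 0"
    and bound: "mero_holds_on_disk
      (\<lambda>w. cmod w < R / (1 + R) * cmod (\<beta> + \<gamma> * (of_nat n + 1)))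
      (\<lambda>z. \<beta> * (z * deriv f z / f z - 1) + \<gamma> * (z * deriv (deriv f) z / deriv f z))"
    and z: "z \<in> unit_disk"
  obtains L where "(\<lambda>z. f z / (z * deriv f z)) \<midarrow>z\<rightarrow> L" "cmod (L - 1) < R"
proof -
  define g where "g z = f z / (z * deriv f z)" for z
  define e where "e z = \<beta> * (z * deriv f z / f z - 1) + \<gamma> * (z * deriv (deriv f) z / deriv f z)" for z
  have hol: "f holomorphic_on unit_disk" using f by (simp add: class_A_def)
  obtain \<phi> where \<phi>: "\<phi> holomorphic_on unit_disk"
    and f_eq: "\<And>z. z \<in> unit_disk \<Longrightarrow> f z = z + z ^ (n + 1) * \<phi> z"
    using class_A_factorization[OF f] by blast
  \<comment> \<open>Chosen so that \<open>f z - z * f' z = z ^ (n + 1) * \<psi> z\<close>; hence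
    \<open>h * f' = z ^ n * \<psi>\<close> for \<open>h = g - 1\<close>.\<close>
  define \<psi> where "\<psi> z = - of_nat n * \<phi> z - z * deriv \<phi> z" for z
  have hol': "deriv f holomorphic_on unit_disk" "deriv \<phi> holomorphic_on unit_disk"
    using hol \<phi> by (auto intro!: holomorphic_deriv)
  hence hol'': "deriv (deriv f) holomorphic_on unit_disk" by (auto intro!: holomorphic_deriv)
  have \<psi>: "\<psi> holomorphic_on unit_disk"
    unfolding \<psi>_def by (intro holomorphic_intros \<phi> hol')
  have deriv_eq: "deriv f z = 1 + of_nat (n + 1) * z ^ n * \<phi> z + z ^ (n + 1) * deriv \<phi> z"
    if "z \<in> unit_disk" for z
  proof -
    have der: "(\<phi> has_field_derivative deriv \<phi> z) (at z)"
      using \<phi> that holomorphic_derivI by blast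
    have "((\<lambda>z. z + z ^ (n + 1) * \<phi> z) has_field_derivative
        1 + of_nat (n + 1) * z ^ n * \<phi> z + z ^ (n + 1) * deriv \<phi> z) (at z)"
      by (rule derivative_eq_intros der refl)+ (simp add: algebra_simps)
    hence "(f has_field_derivative
        1 + of_nat (n + 1) * z ^ n * \<phi> z + z ^ (n + 1) * deriv \<phi> z) (at z)"
      by (rule has_field_derivative_transform_within_open[of _ _ _ unit_disk]) (use f_eq that in auto)
    thus ?thesis by (rule DERIV_imp_deriv)
  qed
  have f'0: "deriv f 0 = 1" using deriv_eq[of 0] n by simp
  have "\<exists>z\<in>unit_disk. f z \<noteq> 0"
  proof (rule ccontr)
    assume "\<not> ?thesis"
    hence "eventually (\<lambda>z. f z = (\<lambda>_. 0) z) (nhds 0)"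
      using eventually_nhds_in_open[of unit_disk 0] by (auto elim!: eventually_mono)
    from deriv_cong_ev[OF this refl] show False using f'0 by simp
  qed
  then obtain z0 where z0: "z0 \<in> unit_disk" "f z0 \<noteq> 0" by blast
  \<comment> \<open>At good points no denominator vanishes and HOL division is genuine. As
    \<open>f\<close> and \<open>f'\<close> are not identically zero, their zeros are isolated, so
    every point of the disk has a punctured neighbourhood of good points.\<close>
  define good where "good w \<longleftrightarrow> w \<in> unit_disk \<and> w \<noteq> 0 \<and> f w \<noteq> 0 \<and> deriv f w \<noteq> 0" for w
  have good: "eventually good (at z)" if "z \<in> unit_disk" for z
  proof -
    have "eventually (\<lambda>w. f w \<noteq> 0 \<and> w \<in> unit_disk) (at z)"
      using non_zero_neighbour_alt[OF hol open_ball connected_ball that z0] .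
    moreover have "eventually (\<lambda>w. deriv f w \<noteq> 0 \<and> w \<in> unit_disk) (at z)"
      using non_zero_neighbour_alt[OF hol'(1) open_ball connected_ball that, of 0] f'0 by simp
    moreover have "eventually (\<lambda>w. w \<noteq> 0) (at z)"
      using eventually_neq_at_within[of 0 z UNIV] .
    ultimately show ?thesis by eventually_elim (auto simp: good_def)
  qed
  have ana: "f analytic_on unit_disk" "deriv f analytic_on unit_disk"
    "deriv (deriv f) analytic_on unit_disk"
    using hol hol' hol'' by (simp_all add: analytic_on_open)
  have good_ana: "g analytic_on {w}" "e analytic_on {w}" if "good w" for w
  proof -
    have "{w} \<subseteq> unit_disk" using that by (auto simp: good_def)
    note ana' = ana[THEN analytic_on_subset, OF this]
    show "g analytic_on {w}" "e analytic_on {w}"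
      unfolding g_def e_def using that by (auto intro!: analytic_intros ana' simp: good_def)
  qed
  have mero: "g meromorphic_on unit_disk" "e meromorphic_on unit_disk"
    unfolding g_def e_def
    by (intro meromorphic_intros ana[THEN analytic_on_imp_meromorphic_on])+
  have e_eq: "e w = (\<beta> + \<gamma>) * (inverse (g w) - 1) - \<gamma> * (w * (deriv g w / g w))" if "good w" for w
    using operator_via_reciprocal[OF hol open_ball, of w \<beta> \<gamma>] that
    unfolding e_def g_def good_def by blast
  have e_not_pole: "\<not> is_pole e z" if "z \<in> unit_disk" for z
    using bound that by (auto simp: mero_holds_on_disk_def e_def[abs_def])
  have isCont: "isCont u z" if "u holomorphic_on unit_disk" "z \<in> unit_disk" for u z
    using that by (meson continuous_on_eq_continuous_at holomorphic_on_imp_continuous_on open_ball)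
  have not_pole: "\<not> is_pole g z" if z: "z \<in> unit_disk" for z
  proof (cases "z = 0")
    case True
    \<comment> \<open>The pole argument needs a nonzero point. At 0, cancelling \<open>w\<close> in
      \<open>f w / (w * f' w)\<close> leaves a quotient with denominator
      \<open>f' 0 = 1\<close>.\<close>
    have "(\<lambda>w. (1 + w ^ n * \<phi> w) / deriv f w) \<midarrow>0\<rightarrow> (1 + 0 ^ n * \<phi> 0) / deriv f 0"
      using isCont[OF \<phi>, of 0] isCont[OF hol'(1), of 0] f'0
      by (intro tendsto_intros) (auto simp: isCont_def)
    moreover have "eventually (\<lambda>w. (1 + w ^ n * \<phi> w) / deriv f w = g w) (at 0)"
      using good[of 0, simplified]
      by eventually_elim (auto simp: g_def good_def f_eq field_simps)
    ultimately have "g \<midarrow>0\<rightarrow> (1 + 0 ^ n * \<phi> 0) / deriv f 0"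
      by (rule Lim_transform_eventually)
    thus ?thesis
      using True not_tendsto_and_filterlim_at_infinity[of "at 0" g] by (auto simp: is_pole_def)
  next
    case False
    show ?thesis
    proof
      assume pole: "is_pole g z"
      have "isolated_singularity_at g z" using mero(1) z meromorphic_on_isolated_singularity
        by (meson meromorphic_on_subset empty_subsetI insert_subset)
      from is_pole_log_derivative_expression[OF this pole \<gamma> False, of "\<beta> + \<gamma>"]
      have "is_pole e z"
        by (rule is_pole_cong[THEN iffD1, rotated 2])
          (use good[OF z] in \<open>auto elim!: eventually_mono simp: e_eq\<close>)
      thus False using e_not_pole z by blast
    qed
  qed
  define h where "h z = remove_sings g z - 1" for z
  define E where "E = remove_sings e"
  have removed: "remove_sings u holomorphic_on unit_disk"
    if u: "u meromorphic_on unit_disk" and np: "\<And>z. z \<in> unit_disk \<Longrightarrow> \<not> is_pole u z" for u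
  proof -
    have "\<forall>z\<in>unit_disk. \<not> is_pole (remove_sings u) z"
      using np u by (meson empty_subsetI insert_subset is_pole_remove_sings_iff
        meromorphic_on_isolated_singularity meromorphic_on_subset)
    with remove_sings_nicely_meromorphic[OF u] show ?thesis
      using nicely_meromorphic_without_singularities analytic_imp_holomorphic by blast
  qed
  have h_hol: "h holomorphic_on unit_disk" and E_hol: "E holomorphic_on unit_disk"
    unfolding h_def E_def using removed[OF mero(1) not_pole] removed[OF mero(2) e_not_pole]
    by (auto intro!: holomorphic_intros)
  have good_eq: "h w = g w - 1" "deriv h w = deriv g w" "E w = e w" if "good w" for w
  proof -
    show "h w = g w - 1" "E w = e w" using good_ana[OF that] by (simp_all add: h_def E_def)
    have "remove_sings g field_differentiable at w"
      using removed[OF mero(1) not_pole] that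
      by (auto simp: good_def intro: holomorphic_on_imp_differentiable_at)
    thus "deriv h w = deriv g w"
      using good_ana(1)[OF that] by (simp add: h_def[abs_def])
  qed
  \<comment> \<open>At good points this is \<open>e_eq\<close> multiplied by
    \<open>g = 1 + h\<close>; both sides are continuous on the disk.\<close>
  have ode: "\<gamma> * (z * deriv h z) + (\<beta> + \<gamma>) * h z = - E z * (1 + h z)" if z: "z \<in> unit_disk" for z
  proof (rule isCont_eq_limit[where z = z])
    show "isCont (\<lambda>z. \<gamma> * (z * deriv h z) + (\<beta> + \<gamma>) * h z) z" "isCont (\<lambda>z. - E z * (1 + h z)) z"
      by (intro isCont[OF _ z] holomorphic_intros h_hol E_hol holomorphic_deriv open_ball)+
    show "eventually (\<lambda>w. \<gamma> * (w * deriv h w) + (\<beta> + \<gamma>) * h w = - E w * (1 + h w)) (at z)"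
      using good[OF z]
    proof eventually_elim
      case (elim w)
      have "g w \<noteq> 0" using elim by (auto simp: good_def g_def)
      thus ?case unfolding good_eq[OF elim] e_eq[OF elim] by (simp add: field_simps)
    qed
  qed
  have h_factor: "h z * deriv f z = z ^ n * \<psi> z" if z: "z \<in> unit_disk" for z
  proof (rule isCont_eq_limit[where z = z])
    show "isCont (\<lambda>z. h z * deriv f z) z" "isCont (\<lambda>z. z ^ n * \<psi> z) z"
      by (intro isCont[OF _ z] holomorphic_intros h_hol hol' \<psi>)+
    show "eventually (\<lambda>w. h w * deriv f w = w ^ n * \<psi> w) (at z)"
      using good[OF z]
    proof eventually_elim
      case (elim w)
      hence w: "w \<in> unit_disk" "w \<noteq> 0" "deriv f w \<noteq> 0" by (auto simp: good_def)
      have "w * (h w * deriv f w) = f w - w * deriv f w"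
        using w by (simp add: good_eq[OF elim] g_def field_simps)
      also have "\<dots> = w * (w ^ n * \<psi> w)"
        unfolding f_eq[OF w(1)] deriv_eq[OF w(1)] \<psi>_def by (simp add: algebra_simps)
      finally show ?case using w by simp
    qed
  qed
  \<comment> \<open>Away from 0, \<open>k\<close> is \<open>\<psi> / f'\<close> at good points;
    since \<open>f' 0 = 1\<close>, its limit at 0 is \<open>\<psi> 0\<close>.\<close>
  define k where "k z = (if z = 0 then \<psi> 0 else h z / z ^ n)" for z
  have k_hol: "k holomorphic_on unit_disk"
  proof (rule no_isolated_singularity'[of "{0}"])
    have "(\<lambda>w. \<psi> w / deriv f w) \<midarrow>0\<rightarrow> \<psi> 0 / deriv f 0"
      using isCont[OF \<psi>, of 0] isCont[OF hol'(1), of 0] f'0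
      by (intro tendsto_intros) (auto simp: isCont_def)
    moreover have "eventually (\<lambda>w. \<psi> w / deriv f w = k w) (at 0)"
      using good[of 0, simplified]
      by eventually_elim (use h_factor in \<open>auto simp: k_def good_def field_simps\<close>)
    ultimately have "k \<midarrow>0\<rightarrow> \<psi> 0 / deriv f 0"
      by (rule Lim_transform_eventually)
    hence "k \<midarrow>0\<rightarrow> k 0" by (simp add: k_def f'0)
    thus "(k \<longlongrightarrow> k z) (at z within unit_disk)" if "z \<in> {0}" for z
      using that by (auto intro: tendsto_within_subset)
    have "(\<lambda>z. h z / z ^ n) holomorphic_on unit_disk - {0}"
      by (intro holomorphic_intros holomorphic_on_subset[OF h_hol]) auto
    thus "k holomorphic_on unit_disk - {0}"
      by (rule holomorphic_transform) (auto simp: k_def)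
  qed auto
  have h_k: "h z = z ^ n * k z" if "z \<in> unit_disk" for z
    using h_factor[of 0] f'0 n by (cases "z = 0") (auto simp: k_def)
  have "cmod (E z) < R / (1 + R) * cmod (\<beta> + \<gamma> * (of_nat n + 1))" if "z \<in> unit_disk" for z
    using bound that by (auto simp: mero_holds_on_disk_def e_def[abs_def] E_def)
  from disk_bound_from_differential_equation[OF k_hol h_k n \<gamma> Re R ode this z]
  have "cmod (remove_sings g z - 1) < R" by (simp add: h_def)
  moreover have "g \<midarrow>z\<rightarrow> remove_sings g z"
  proof -
    have "not_essential g z"
      using meromorphic_on_subset[OF mero(1), of "{z}"] z by (simp add: meromorphic_at_iff)
    with not_pole[OF z] obtain c where "g \<midarrow>z\<rightarrow> c" by (auto simp: not_essential_def)
    thus ?thesis using remove_sings_eqI by metis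
  qed
  ultimately show ?thesis using that unfolding g_def[abs_def] by blast
qed

section \<open>Inclusion of disks and inversion to the half-plane\<close>

theorem theorem2:
  fixes n :: nat and f :: "complex \<Rightarrow> complex" and \<beta> \<gamma> :: complex and \<alpha> :: real
  assumes "n \<ge> 1"
    and "f \<in> class_A n"
    and "\<gamma> \<noteq> 0"
    and "Re (\<beta> / \<gamma>) > - (real n + 1)"
    and "0 < \<alpha>" and "\<alpha> < 1"
    and "(0 < \<alpha> \<and> \<alpha> \<le> 1 / 2 \<and>
           mero_holds_on_disk
             (\<lambda>w. cmod w < 1 / 2 * cmod (\<beta> + \<gamma> * (of_nat n + 1)))
             (\<lambda>z. \<beta> * (z * deriv f z / f z - 1) + \<gamma> * (z * deriv (deriv f) z / deriv f z)))
       \<or> (1 / 2 \<le> \<alpha> \<and> \<alpha> < 1 \<and>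
           mero_holds_on_disk
             (\<lambda>w. cmod w < (1 - \<alpha>) * cmod (\<beta> + \<gamma> * (of_nat n + 1)))
             (\<lambda>z. \<beta> * (z * deriv f z / f z - 1) + \<gamma> * (z * deriv (deriv f) z / deriv f z)))"
  shows "mero_holds_on_disk
           (\<lambda>w. cmod (w - complex_of_real (1 / (2 * \<alpha>))) < 1 / (2 * \<alpha>))
           (\<lambda>z. f z / (z * deriv f z))
       \<and> f \<in> starlike_class n \<alpha>"
proof -
  let ?e = "\<lambda>z. \<beta> * (z * deriv f z / f z - 1) + \<gamma> * (z * deriv (deriv f) z / deriv f z)"
  let ?g = "\<lambda>z. f z / (z * deriv f z)"
  \<comment> \<open>The second condition says that the disk of radius \<open>R\<close> about 1 lies
    in the target disk. Both choices of \<open>R\<close> give equality: the circles touch at 0 in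
    case (i) and at \<open>1 / \<alpha>\<close> in case (ii).\<close>
  obtain R where R: "R > 0" "R + \<bar>1 / (2 * \<alpha>) - 1\<bar> \<le> 1 / (2 * \<alpha>)"
    "mero_holds_on_disk (\<lambda>w. cmod w < R / (1 + R) * cmod (\<beta> + \<gamma> * (of_nat n + 1))) ?e"
    using assms(7)
  proof (elim disjE conjE)
    assume *: "\<alpha> \<le> 1 / 2"
      "mero_holds_on_disk (\<lambda>w. cmod w < 1 / 2 * cmod (\<beta> + \<gamma> * (of_nat n + 1))) ?e"
    have "1 \<le> 1 / (2 * \<alpha>)" using *(1) \<open>0 < \<alpha>\<close> by simp
    thus thesis using that[of 1] *(2) by simp
  next
    assume *: "1 / 2 \<le> \<alpha>"
      "mero_holds_on_disk (\<lambda>w. cmod w < (1 - \<alpha>) * cmod (\<beta> + \<gamma> * (of_nat n + 1))) ?e"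
    have "(1 - \<alpha>) / \<alpha> / (1 + (1 - \<alpha>) / \<alpha>) = 1 - \<alpha>"
      using \<open>0 < \<alpha>\<close> by (simp add: field_simps)
    moreover have "1 / (2 * \<alpha>) \<le> 1" using *(1) \<open>0 < \<alpha>\<close> by simp
    ultimately show thesis
      using that[of "(1 - \<alpha>) / \<alpha>"] *(2) \<open>0 < \<alpha>\<close> \<open>\<alpha> < 1\<close> by (simp add: diff_divide_distrib)
  qed
  have lim: "\<exists>L. ?g \<midarrow>z\<rightarrow> L \<and> cmod (L - complex_of_real (1 / (2 * \<alpha>))) < 1 / (2 * \<alpha>)"
    if "z \<in> unit_disk" for z
  proof -
    obtain L where L: "?g \<midarrow>z\<rightarrow> L" "cmod (L - 1) < R"
      using reciprocal_minus_one_bound[OF assms(1-4) R(1,3) \<open>z \<in> unit_disk\<close>] by blast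
    have "cmod (L - of_real (1 / (2 * \<alpha>))) \<le> cmod (L - 1) + cmod (1 - of_real (1 / (2 * \<alpha>)))"
      using norm_triangle_ineq[of "L - 1" "1 - of_real (1 / (2 * \<alpha>))"] by simp
    also have "cmod (1 - of_real (1 / (2 * \<alpha>))) = \<bar>1 / (2 * \<alpha>) - 1\<bar>"
      by (metis norm_minus_commute norm_of_real of_real_1 of_real_diff)
    finally show ?thesis using L R(2) by (intro exI[of _ L]) linarith
  qed
  have holds: "mero_holds_on_disk P u"
    if "\<And>z. z \<in> unit_disk \<Longrightarrow> \<exists>L. u \<midarrow>z\<rightarrow> L \<and> P L" for P u
    unfolding mero_holds_on_disk_def is_pole_def
    using that not_tendsto_and_filterlim_at_infinity remove_sings_eqI
    by (metis at_neq_bot)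
  have "mero_holds_on_disk (\<lambda>w. Re w > \<alpha>) (\<lambda>z. z * deriv f z / f z)"
  proof (rule holds)
    fix z :: complex assume "z \<in> unit_disk"
    then obtain L where L: "?g \<midarrow>z\<rightarrow> L" "cmod (L - complex_of_real (1 / (2 * \<alpha>))) < 1 / (2 * \<alpha>)"
      using lim by blast
    note L' = disk_half_plane_inverse[OF \<open>0 < \<alpha>\<close> L(2)]
    \<comment> \<open>The target disk is open and 0 is on its boundary, so
      \<open>L \<noteq> 0\<close> and the limit can be inverted.\<close>
    have "(\<lambda>z. inverse (?g z)) \<midarrow>z\<rightarrow> inverse L" using L(1) L'(1) by (rule tendsto_inverse)
    thus "\<exists>L. (\<lambda>z. z * deriv f z / f z) \<midarrow>z\<rightarrow> L \<and> Re L > \<alpha>"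
      using L'(2) by (auto simp: inverse_eq_divide)
  qed
  with holds[OF lim] assms(2) show ?thesis by (simp add: starlike_class_def)
qed

end
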